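(* Fix an integer $N>0$ and tuples of non-negative integers $\mathbf{n}=(n_0,\dots,n_{N-1})$, $\mathbf{m}=(m_0,\dots,m_{N-1})$ with $0 \leqslant n_0 < \cdots < n_{N-1}$ and $0 \leqslant m_0 < \cdots < m_{N-1}$, such that $n_j \leqslant m_j$ for all $j$. Then the function $$f : (0,+\infty)^N \to \mathbb{R}, \qquad f(\mathbf{u}) := \frac{s_{\mathbf{m}}(\mathbf{u})}{s_{\mathbf{n}}(\mathbf{u})}$$ is non-decreasing in each coordinate.
   Context: For a strictly increasing tuple of non-negative integers $\mathbf{n} = (n_0,\dots,n_{N-1})$, the Schur polynomial $s_{\mathbf{n}}(u_1,\dots,u_N)$ is $\sum_T \prod_{i=1}^N u_i^{a_i(T)}$, where $T$ ranges over all Young tableaux of shape $(n_{N-1}-(N-1), \dots, n_1-1, n_0)$ with cell entries in $\{1,\dots,N\}$, whose entries weakly decrease along each row and strictly decrease down each column, and $a_i(T)$ is the number of occurrences of $i$ in $T$. Equivalently, $s_{\mathbf{n}}$ is the polynomial satisfying $\det(u_j^{n_{k-1}})_{j,k=1}^N = s_{\mathbf{n}}(u_1,\dots,u_N)\prod_{1\leqslant j<k\leqslant N}(u_k-u_j)$. It is positive on $(0,+\infty)^N$. *)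

theory Defs
  imports Complex_Main "HOL-Library.FuncSet"
begin

text \<open>
  Exponent tuples \<open>(n_0, \<dots>, n_{N-1})\<close> are functions \<open>nat \<Rightarrow> nat\<close> restricted to \<open>{..<N}\<close>, and
  points \<open>(u_1, \<dots>, u_N)\<close> are functions \<open>nat \<Rightarrow> real\<close> restricted to \<open>{1..N}\<close>; values outside
  these index sets are irrelevant.
\<close>

text \<open>
  Row \<open>r\<close> (counted from \<open>0\<close>, topmost row first) has length \<open>n_{N-1-r} - (N-1-r)\<close>.  The natural
  number subtraction does not truncate, as \<open>n_j \<ge> j\<close> for strictly increasing tuples.
\<close>

definition row_length :: "nat \<Rightarrow> (nat \<Rightarrow> nat) \<Rightarrow> nat \<Rightarrow> nat" where
  "row_length N n r = n (N - 1 - r) - (N - 1 - r)"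

definition cells :: "nat \<Rightarrow> (nat \<Rightarrow> nat) \<Rightarrow> (nat \<times> nat) set" where
  "cells N n = (SIGMA r:{..<N}. {..<row_length N n r})"

text \<open>
  A tableau maps a cell (row, column) to its entry.  It is extensional, that is, \<open>undefined\<close>
  outside the diagram, so that distinct functions are distinct tableaux.
\<close>

definition tableaux :: "nat \<Rightarrow> (nat \<Rightarrow> nat) \<Rightarrow> (nat \<times> nat \<Rightarrow> nat) set" where
  "tableaux N n = {T \<in> cells N n \<rightarrow>\<^sub>E {1..N}.
     (\<forall>r c c'. (r, c) \<in> cells N n \<longrightarrow> (r, c') \<in> cells N n \<longrightarrow> c < c' \<longrightarrow> T (r, c') \<le> T (r, c)) \<and>
     (\<forall>r r' c. (r, c) \<in> cells N n \<longrightarrow> (r', c) \<in> cells N n \<longrightarrow> r < r' \<longrightarrow> T (r', c) < T (r, c))}"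

definition occurrences :: "nat \<Rightarrow> (nat \<Rightarrow> nat) \<Rightarrow> (nat \<times> nat \<Rightarrow> nat) \<Rightarrow> nat \<Rightarrow> nat" where
  "occurrences N n T i = card {x \<in> cells N n. T x = i}"

definition schur :: "nat \<Rightarrow> (nat \<Rightarrow> nat) \<Rightarrow> (nat \<Rightarrow> real) \<Rightarrow> real" where
  "schur N n u = (\<Sum>T\<in>tableaux N n. \<Prod>i=1..N. u i ^ occurrences N n T i)"

lemma finite_cells: "finite (cells N n)"
  by (simp add: cells_def)

lemma finite_tableaux: "finite (tableaux N n)"
  by (rule finite_subset[of _ "cells N n \<rightarrow>\<^sub>E {1..N}"])
    (auto simp: tableaux_def intro: finite_PiE finite_cells)

end

theory Submission
  imports Defs "Jordan_Normal_Form.Determinant"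
begin

text \<open>
  Suppose first that \<open>m\<close> and \<open>n\<close> differ only in one entry, \<open>n\<^sub>k < m\<^sub>k\<close>.  Let only one variable vary,
  let \<open>U\<close> be the others, and let \<open>s < t\<close>.  Write \<open>e\<close> for \<open>n\<close> with \<open>m\<^sub>k\<close> inserted after \<open>n\<^sub>k\<close>, and \<open>a\<close> for
  \<open>n\<close> with \<open>n\<^sub>k\<close> omitted.  The claim follows from the identity

    \<open>s\<^sub>m(t, U) s\<^sub>n(s, U) - s\<^sub>m(s, U) s\<^sub>n(t, U) = (t - s) s\<^sub>e(s, t, U) s\<^sub>a(U)\<close>,

  whose right-hand side is nonnegative because Schur polynomials have nonnegative coefficients
  (\<open>schur0_plucker\<close>).  The identity is a Pluecker relation between the determinants
  \<open>det(u\<^sub>j ^ n\<^sub>k)\<close> (\<open>alternant_plucker\<close>), divided by Vandermonde products.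

  To pass from tableaux to determinants, the bialternant formula is proved by induction on the number
  of variables (\<open>alternant_eq_schur0_vandermonde\<close>): removing all ones from a tableau
  (\<open>schur0_Suc\<close>) and clearing one column of the determinant (\<open>alternant_Suc\<close>) produce the same
  recursion.  The formula also shows that Schur polynomials are symmetric (\<open>schur0_permute\<close>), so that
  the varying variable may be taken to be the first one.

  The division requires distinct points; the resulting inequality extends to all positive points
  by continuity (\<open>schur0_cross_le\<close>).  Finally, \<open>n\<close> is transformed into \<open>m\<close> by changing one entry at
  a time, and the ratio in question is the product of the ratios for these steps.
\<close>

section \<open>The branching rule for tableaux\<close>

text \<open>
  If \<open>n\<close> has \<open>N + 1\<close> entries and encodes the partition \<open>\<lambda>\<close>, these are the \<open>N\<close>-tuples \<open>n'\<close> that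
  encode the partitions \<open>\<mu>\<close> with \<open>\<lambda>\<^sub>r \<ge> \<mu>\<^sub>r \<ge> \<lambda>\<^sub>r\<^sub>+\<^sub>1\<close>, that is, those for which \<open>\<lambda> / \<mu>\<close> is a
  horizontal strip.  The shift by the position, which turns parts into exponents, makes one of the
  two bounds strict.
\<close>

definition interlacing :: "nat \<Rightarrow> (nat \<Rightarrow> nat) \<Rightarrow> (nat \<Rightarrow> nat) set" where
  "interlacing N n = (\<Pi>\<^sub>E k\<in>{..<N}. {n k..<n (Suc k)})"

lemma mem_cells: "(r, c) \<in> cells N n \<longleftrightarrow> r < N \<and> c < row_length N n r"
  by (auto simp: cells_def)

lemma row_length_antimono:
  assumes "strict_mono_on {..<N} n" "r \<le> r'" "r' < N"
  shows "row_length N n r' \<le> row_length N n r"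
  using assms(2,3)
proof (induction r' rule: dec_induct)
  case (step r')
  let ?j = "N - 1 - Suc r'"
  have "n ?j < n (Suc ?j)"
    using assms(1) step.prems by (auto simp: strict_mono_on_def)
  moreover have "N - 1 - r' = Suc ?j" using step.prems by simp
  ultimately have "row_length N n (Suc r') \<le> row_length N n r'"
    unfolding row_length_def by simp
  with step show ?case by simp
qed simp

lemma interlacing_strict_mono:
  assumes "strict_mono_on {..<Suc N} n" "n' \<in> interlacing N n"
  shows "strict_mono_on {..<N} n'"
proof (rule strict_mono_onI)
  fix r s assume rs: "r \<in> {..<N}" "s \<in> {..<N}" "r < s"
  have "n' r < n (Suc r)" "n s \<le> n' s"
    using assms(2) rs by (auto simp: interlacing_def PiE_iff)
  moreover have "n (Suc r) \<le> n s"
    using strict_mono_on_leD[OF assms(1), of "Suc r" s] rs by auto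
  ultimately show "n' r < n' s" by simp
qed

lemma strict_mono_on_ge_self:
  fixes n :: "nat \<Rightarrow> nat"
  assumes "strict_mono_on {..<N} n"
  shows "j < N \<Longrightarrow> j \<le> n j"
proof (induction j)
  case (Suc j)
  then show ?case using strict_mono_onD[OF assms, of j "Suc j"] by simp
qed simp

lemma interlacing_row_length:
  assumes n: "strict_mono_on {..<Suc N} n" and n': "n' \<in> interlacing N n" and r: "r < N"
  shows "row_length (Suc N) n (Suc r) \<le> row_length N n' r"
    "row_length N n' r \<le> row_length (Suc N) n r"
proof -
  obtain j where j: "N = Suc (r + j)" using less_imp_Suc_add[OF r] by auto
  have "n j \<le> n' j" "n' j < n (Suc j)"
    using n' by (auto simp: interlacing_def PiE_iff j)
  moreover have "row_length (Suc N) n (Suc r) = n j - j" "row_length N n' r = n' j - j"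
    "row_length (Suc N) n r = n (Suc j) - Suc j"
    by (simp_all add: row_length_def j)
  ultimately show "row_length (Suc N) n (Suc r) \<le> row_length N n' r"
    "row_length N n' r \<le> row_length (Suc N) n r"
    by linarith+
qed

lemma interlacing_cells_subset:
  assumes "strict_mono_on {..<Suc N} n" "n' \<in> interlacing N n"
  shows "cells N n' \<subseteq> cells (Suc N) n"
  using interlacing_row_length(2)[OF assms] by (fastforce simp: cells_def)

text \<open>
  This number of cells is written in the exponents, not in the row lengths, so that it matches
  the power of the first variable in the determinant recursion below.
\<close>

lemma card_removed_strip:
  assumes n: "strict_mono_on {..<Suc N} n" and n': "n' \<in> interlacing N n"
  shows "card (cells (Suc N) n - cells N n') = n 0 + (\<Sum>k<N. n (Suc k) - Suc (n' k))"
proof -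
  let ?l = "row_length (Suc N) n" and ?l' = "\<lambda>r. if r < N then row_length N n' r else 0"
  have "cells (Suc N) n - cells N n' = (SIGMA r:{..<Suc N}. {?l' r..<?l r})"
    by (auto simp: cells_def split: if_splits)
  hence "card (cells (Suc N) n - cells N n') = (\<Sum>r<Suc N. ?l r - ?l' r)"
    by simp
  also have "\<dots> = n 0 + (\<Sum>r<N. ?l r - ?l' r)"
    by (simp add: row_length_def)
  also have "(\<Sum>r<N. ?l r - ?l' r) = (\<Sum>r<N. n (Suc (N - Suc r)) - Suc (n' (N - Suc r)))"
  proof (rule sum.cong)
    fix r assume "r \<in> {..<N}"
    then obtain j where j: "N = Suc (r + j)" using less_imp_Suc_add[of r N] by auto
    have "j \<le> n' j"
      by (rule strict_mono_on_ge_self[OF interlacing_strict_mono[OF n n']]) (simp add: j)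
    moreover have "N - r = Suc j" "N - Suc r = j" "N - 1 - r = j" "Suc N - 1 - r = Suc j" "r < N"
      by (simp_all add: j)
    ultimately show "?l r - ?l' r = n (Suc (N - Suc r)) - Suc (n' (N - Suc r))"
      by (simp only: row_length_def if_True) simp
  qed simp
  also have "\<dots> = (\<Sum>k<N. n (Suc k) - Suc (n' k))"
    by (rule sum.nat_diff_reindex)
  finally show ?thesis .
qed

lemma interlacing_determined_by_cells:
  assumes n: "strict_mono_on {..<Suc N} n" and n': "n' \<in> interlacing N n" "n'' \<in> interlacing N n"
    and eq: "cells N n' = cells N n''"
  shows "n' = n''"
proof
  fix j
  show "n' j = n'' j"
  proof (cases "j < N")
    case True
    then obtain r where r: "N = Suc (j + r)" using less_imp_Suc_add[of j N] by auto
    have "(r, c) \<in> cells N n' \<longleftrightarrow> (r, c) \<in> cells N n''" for c using eq by simp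
    hence "c < row_length N n' r \<longleftrightarrow> c < row_length N n'' r" for c
      by (simp add: mem_cells r)
    hence "row_length N n' r = row_length N n'' r"
      by (metis linorder_neqE_nat nat_less_le)
    hence "n' j - j = n'' j - j"
      by (simp add: row_length_def r)
    moreover have "j \<le> n' j" "j \<le> n'' j"
      using True n' by (blast intro: strict_mono_on_ge_self[OF interlacing_strict_mono[OF n]])+
    ultimately show ?thesis by linarith
  next
    case False
    thus ?thesis using n' by (auto simp: interlacing_def PiE_iff extensional_def)
  qed
qed

lemma tableaux_entry:
  assumes "T \<in> tableaux N n" "(r, c) \<in> cells N n"
  shows "1 \<le> T (r, c)" "T (r, c) \<le> N"
  using assms by (auto simp: tableaux_def PiE_iff)

lemma tableaux_outside: "T \<in> tableaux N n \<Longrightarrow> x \<notin> cells N n \<Longrightarrow> T x = undefined"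
  by (auto simp: tableaux_def dest: PiE_arb)

lemma tableaux_row:
  "T \<in> tableaux N n \<Longrightarrow> (r, c) \<in> cells N n \<Longrightarrow> (r, c') \<in> cells N n \<Longrightarrow> c \<le> c' \<Longrightarrow> T (r, c') \<le> T (r, c)"
  by (cases "c = c'") (auto simp: tableaux_def)

lemma tableaux_col:
  "T \<in> tableaux N n \<Longrightarrow> (r, c) \<in> cells N n \<Longrightarrow> (r', c) \<in> cells N n \<Longrightarrow> r < r' \<Longrightarrow> T (r', c) < T (r, c)"
  by (auto simp: tableaux_def)

text \<open>
  Entries drop by at least one with every row of a column.  In particular the bottom one of
  \<open>N + 1\<close> rows of a tableau with entries in \<open>{1..N + 1}\<close> contains only ones, so that it
  disappears when the ones are removed.
\<close>

lemma tableaux_entry_row_bound: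
  assumes n: "strict_mono_on {..<N} n" and T: "T \<in> tableaux N n"
  shows "(r, c) \<in> cells N n \<Longrightarrow> T (r, c) + r \<le> N"
proof (induction r)
  case 0
  then show ?case using tableaux_entry(2)[OF T, of 0] by simp
next
  case (Suc r)
  have "(r, c) \<in> cells N n"
    using Suc.prems row_length_antimono[OF n, of r "Suc r"] by (auto simp: mem_cells)
  with Suc.IH tableaux_col[OF T this Suc.prems] show ?case by simp
qed

lemma down_closed_eq_lessThan:
  fixes A :: "nat set"
  assumes "finite A" "\<And>x y. x \<in> A \<Longrightarrow> y \<le> x \<Longrightarrow> y \<in> A"
  shows "x \<in> A \<longleftrightarrow> x < card A"
proof -
  have "\<exists>m. A = {..<m}"
  proof (cases "A = {}")
    case False
    have "x \<in> A \<longleftrightarrow> x < Suc (Max A)" for x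
      using assms(2)[OF Max_in[OF assms(1) False], of x] Max_ge[OF assms(1), of x]
      unfolding less_Suc_eq_le by blast
    thus ?thesis by blast
  qed auto
  thus ?thesis by auto
qed

text \<open>
  As rows decrease weakly, the entries above \<open>1\<close> form an initial segment of each row.  It is at
  least as long as the next row, because an entry that has a cell below it is at least \<open>2\<close>.
\<close>

lemma tableau_shape_without_ones:
  assumes n: "strict_mono_on {..<Suc N} n" and T: "T \<in> tableaux (Suc N) n"
  obtains n' where "n' \<in> interlacing N n" "{x \<in> cells (Suc N) n. T x > 1} = cells N n'"
proof -
  let ?C = "cells (Suc N) n" and ?l = "row_length (Suc N) n"
  define A where "A r = {c. (r, c) \<in> ?C \<and> T (r, c) > 1}" for r
  have sub: "A r \<subseteq> {..<?l r}" for r by (auto simp: A_def mem_cells)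
  have A: "c \<in> A r \<longleftrightarrow> c < card (A r)" for r c
  proof (rule down_closed_eq_lessThan)
    show "finite (A r)" by (rule finite_subset[OF sub]) simp
    fix x y assume xy: "x \<in> A r" "y \<le> x"
    hence "(r, y) \<in> ?C" by (auto simp: A_def mem_cells)
    thus "y \<in> A r" using xy tableaux_row[OF T, of r y x] by (auto simp: A_def)
  qed
  have AN: "A r = {}" if "r \<ge> N" for r
  proof -
    have "\<not> T (r, c) > 1" if "(r, c) \<in> ?C" for c
      using tableaux_entry_row_bound[OF n T that] \<open>r \<ge> N\<close> by linarith
    thus ?thesis by (auto simp: A_def)
  qed
  have up: "card (A r) \<le> ?l r" for r
    using card_mono[OF _ sub[of r]] by simp
  have low: "?l (Suc r) \<le> card (A r)" if "r < N" for r
  proof -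
    have "c < card (A r)" if c: "c < ?l (Suc r)" for c
    proof -
      have "(Suc r, c) \<in> ?C" "(r, c) \<in> ?C"
        using c \<open>r < N\<close> row_length_antimono[OF n, of r "Suc r"] by (auto simp: mem_cells)
      with tableaux_col[OF T this(2,1)] tableaux_entry(1)[OF T this(1)] have "c \<in> A r"
        by (simp add: A_def)
      thus ?thesis unfolding A .
    qed
    thus ?thesis by (meson less_irrefl not_le)
  qed
  define n' where "n' = (\<lambda>j\<in>{..<N}. card (A (N - 1 - j)) + j)"
  have "n' \<in> interlacing N n"
    unfolding interlacing_def
  proof (rule PiE_I)
    fix j assume "j \<in> {..<N}"
    then obtain r where r: "N = Suc (j + r)" using less_imp_Suc_add[of j N] by auto
    have "?l (Suc r) \<le> card (A r)" "card (A r) \<le> ?l r"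
      by (rule low, simp add: r) (rule up)
    moreover have "?l (Suc r) = n j - j" "?l r = n (Suc j) - Suc j"
      by (simp_all add: row_length_def r)
    moreover have "Suc j \<le> n (Suc j)" "j \<le> n j"
      by (rule strict_mono_on_ge_self[OF n], simp add: r)+
    ultimately have "card (A r) + j \<in> {n j..<n (Suc j)}" by auto
    moreover have "n' j = card (A r) + j" by (simp add: n'_def r)
    ultimately show "n' j \<in> {n j..<n (Suc j)}" by simp
  qed (simp add: n'_def)
  moreover have "row_length N n' r = card (A r)" if "r < N" for r
    using that by (simp add: row_length_def n'_def)
  hence "(r, c) \<in> cells N n' \<longleftrightarrow> c \<in> A r" for r c
    using A[of c r] AN[of r] by (cases "r < N") (auto simp: mem_cells)
  hence "{x \<in> ?C. T x > 1} = cells N n'"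
    by (auto simp: A_def)
  ultimately show ?thesis using that by blast
qed

definition remove_ones :: "nat \<Rightarrow> (nat \<Rightarrow> nat) \<Rightarrow> (nat \<times> nat \<Rightarrow> nat) \<Rightarrow> nat \<times> nat \<Rightarrow> nat" where
  "remove_ones N n' T = (\<lambda>x\<in>cells N n'. T x - 1)"

definition add_ones ::
    "nat \<Rightarrow> (nat \<Rightarrow> nat) \<Rightarrow> (nat \<Rightarrow> nat) \<Rightarrow> (nat \<times> nat \<Rightarrow> nat) \<Rightarrow> nat \<times> nat \<Rightarrow> nat" where
  "add_ones N n n' T = (\<lambda>x\<in>cells (Suc N) n. if x \<in> cells N n' then Suc (T x) else 1)"

text \<open>
  The fibre, over the shape of \<open>n'\<close>, of the map that removes the ones of a tableau; over an
  interlacing \<open>n'\<close> it is in bijection with \<open>tableaux N n'\<close>.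
\<close>

definition tableaux_over :: "nat \<Rightarrow> (nat \<Rightarrow> nat) \<Rightarrow> (nat \<Rightarrow> nat) \<Rightarrow> (nat \<times> nat \<Rightarrow> nat) set" where
  "tableaux_over N n n' = {T \<in> tableaux (Suc N) n. {x \<in> cells (Suc N) n. T x > 1} = cells N n'}"

lemma remove_ones_tableaux:
  assumes T: "T \<in> tableaux_over N n n'"
  shows "remove_ones N n' T \<in> tableaux N n'"
proof -
  let ?C = "cells (Suc N) n" and ?C' = "cells N n'"
  have T': "T \<in> tableaux (Suc N) n" and C': "?C' = {x \<in> ?C. T x > 1}"
    using T by (auto simp: tableaux_over_def)
  have C: "x \<in> ?C" "T x > 1" if "x \<in> ?C'" for x using that C' by auto
  have e: "T x \<le> Suc N" if "x \<in> ?C" for x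
    using tableaux_entry(2)[OF T'] that by (cases x) auto
  show ?thesis
    unfolding tableaux_def remove_ones_def
  proof (intro CollectI conjI allI impI)
    show "(\<lambda>x\<in>?C'. T x - 1) \<in> ?C' \<rightarrow>\<^sub>E {1..N}"
      using C e by fastforce
  next
    fix r c c' assume "(r, c) \<in> ?C'" "(r, c') \<in> ?C'" "c < c'"
    thus "(\<lambda>x\<in>?C'. T x - 1) (r, c') \<le> (\<lambda>x\<in>?C'. T x - 1) (r, c)"
      using tableaux_row[OF T', of r c c'] C by (simp add: diff_le_mono)
  next
    fix r r' c assume "(r, c) \<in> ?C'" "(r', c) \<in> ?C'" "r < r'"
    thus "(\<lambda>x\<in>?C'. T x - 1) (r', c) < (\<lambda>x\<in>?C'. T x - 1) (r, c)"
      using tableaux_col[OF T', of r c r'] C[of "(r,c)"] C[of "(r',c)"] by simp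
  qed
qed

lemma add_ones_tableaux:
  assumes n: "strict_mono_on {..<Suc N} n" and n': "n' \<in> interlacing N n"
    and T: "T \<in> tableaux N n'"
  shows "add_ones N n n' T \<in> tableaux_over N n n'"
proof -
  let ?C = "cells (Suc N) n" and ?C' = "cells N n'" and ?T = "add_ones N n n' T"
  have sub: "?C' \<subseteq> ?C" by (rule interlacing_cells_subset[OF n n'])
  have e: "1 \<le> T x" "T x \<le> N" if "x \<in> ?C'" for x
    using tableaux_entry[OF T] that by (cases x; auto)+
  have "?T \<in> tableaux (Suc N) n"
    unfolding tableaux_def
  proof (intro CollectI conjI allI impI)
    show "?T \<in> ?C \<rightarrow>\<^sub>E {1..Suc N}"
      using e by (auto simp: add_ones_def)
  next
    fix r c c' assume *: "(r, c) \<in> ?C" "(r, c') \<in> ?C" "c < c'"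
    show "?T (r, c') \<le> ?T (r, c)"
    proof (cases "(r, c') \<in> ?C'")
      case True
      hence "(r, c) \<in> ?C'" using *(3) by (auto simp: mem_cells)
      thus ?thesis using * True tableaux_row[OF T, of r c c'] by (simp add: add_ones_def)
    qed (use * in \<open>auto simp: add_ones_def\<close>)
  next
    fix r r' c assume *: "(r, c) \<in> ?C" "(r', c) \<in> ?C" "r < r'"
    have "r < N" using * by (auto simp: mem_cells)
    moreover have "c < row_length (Suc N) n (Suc r)"
      using * row_length_antimono[OF n, of "Suc r" r'] by (auto simp: mem_cells)
    ultimately have rc: "(r, c) \<in> ?C'"
      using interlacing_row_length(1)[OF n n', of r] by (auto simp: mem_cells)
    thus "?T (r', c) < ?T (r, c)"
      using * e(1)[OF rc] tableaux_col[OF T, of r c r'] by (auto simp: add_ones_def)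
  qed
  moreover have "{x \<in> ?C. ?T x > 1} = ?C'"
    using sub e(1) by (force simp: add_ones_def)
  ultimately show ?thesis by (simp add: tableaux_over_def)
qed

lemma remove_add_ones:
  assumes n: "strict_mono_on {..<Suc N} n" and n': "n' \<in> interlacing N n"
    and T: "T \<in> tableaux N n'"
  shows "remove_ones N n' (add_ones N n n' T) = T"
proof
  fix x
  show "remove_ones N n' (add_ones N n n' T) x = T x"
    using tableaux_outside[OF T, of x] interlacing_cells_subset[OF n n']
    by (auto simp: remove_ones_def add_ones_def)
qed

lemma add_remove_ones:
  assumes T: "T \<in> tableaux_over N n n'"
  shows "add_ones N n n' (remove_ones N n' T) = T"
proof
  fix x
  let ?C = "cells (Suc N) n" and ?C' = "cells N n'"
  have T': "T \<in> tableaux (Suc N) n" and C': "?C' = {x \<in> ?C. T x > 1}"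
    using T by (auto simp: tableaux_over_def)
  have "T x \<ge> 1" if "x \<in> ?C" using tableaux_entry(1)[OF T'] that by (cases x) auto
  moreover have "T x = undefined" if "x \<notin> ?C"
    using tableaux_outside[OF T' that] .
  moreover have "x \<in> ?C' \<longleftrightarrow> x \<in> ?C \<and> T x > 1" using C' by blast
  ultimately show "add_ones N n n' (remove_ones N n' T) x = T x"
    by (cases "x \<in> ?C") (auto simp: remove_ones_def add_ones_def)
qed

lemma tableau_weight_remove_ones:
  fixes v :: "nat \<Rightarrow> real"
  assumes n: "strict_mono_on {..<Suc N} n" and n': "n' \<in> interlacing N n"
    and T: "T \<in> tableaux_over N n n'"
  shows "(\<Prod>i=1..Suc N. v i ^ occurrences (Suc N) n T i)
    = v 1 ^ (n 0 + (\<Sum>k<N. n (Suc k) - Suc (n' k)))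
      * (\<Prod>i=1..N. v (Suc i) ^ occurrences N n' (remove_ones N n' T) i)"
proof -
  let ?C = "cells (Suc N) n" and ?C' = "cells N n'"
  have T': "T \<in> tableaux (Suc N) n" and C': "?C' = {x \<in> ?C. T x > 1}"
    using T by (auto simp: tableaux_over_def)
  have ge: "T x \<ge> 1" if "x \<in> ?C" for x using tableaux_entry(1)[OF T'] that by (cases x) auto
  have "{x \<in> ?C. T x = 1} = ?C - ?C'" using ge C' by force
  hence 1: "occurrences (Suc N) n T 1 = n 0 + (\<Sum>k<N. n (Suc k) - Suc (n' k))"
    unfolding occurrences_def using card_removed_strip[OF n n'] by simp
  have 2: "occurrences (Suc N) n T (Suc i) = occurrences N n' (remove_ones N n' T) i" if "i \<ge> 1" for i
    unfolding occurrences_def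
  proof (rule arg_cong[of _ _ card])
    have "x \<in> ?C' \<longleftrightarrow> x \<in> ?C \<and> T x > 1" for x using C' by blast
    thus "{x \<in> ?C. T x = Suc i} = {x \<in> ?C'. remove_ones N n' T x = i}"
      using that by (auto simp: remove_ones_def)
  qed
  have "(\<Prod>i=1..Suc N. v i ^ occurrences (Suc N) n T i)
      = v 1 ^ occurrences (Suc N) n T 1 * (\<Prod>i=Suc 1..Suc N. v i ^ occurrences (Suc N) n T i)"
    by (rule prod.atLeast_Suc_atMost) simp
  also have "(\<Prod>i=Suc 1..Suc N. v i ^ occurrences (Suc N) n T i)
      = (\<Prod>i=1..N. v (Suc i) ^ occurrences N n' (remove_ones N n' T) i)"
    unfolding prod.atLeast_Suc_atMost_Suc_shift by (intro prod.cong) (auto simp: 2)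
  finally show ?thesis unfolding 1 .
qed

text \<open>
  The Schur polynomial with the variables numbered from \<open>0\<close>, so that the first variable is
  split off by \<open>case_nat\<close> and the remaining ones are reached by composition with \<open>Suc\<close>.
\<close>

definition schur0 :: "nat \<Rightarrow> (nat \<Rightarrow> nat) \<Rightarrow> (nat \<Rightarrow> real) \<Rightarrow> real" where
  "schur0 N n v = schur N n (\<lambda>i. v (i - 1))"

text \<open>
  The branching rule.  It splits off the first variable, not the last one: entries decrease along
  rows and columns here, so it is the smallest entry whose removal leaves a Young diagram.
\<close>

lemma schur0_Suc:
  assumes n: "strict_mono_on {..<Suc N} n"
  shows "schur0 (Suc N) n v = (\<Sum>n'\<in>interlacing N n.
    v 0 ^ (n 0 + (\<Sum>k<N. n (Suc k) - Suc (n' k))) * schur0 N n' (v \<circ> Suc))"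
proof -
  let ?u = "\<lambda>i. v (i - 1)"
  let ?w = "\<lambda>T. \<Prod>i=1..Suc N. ?u i ^ occurrences (Suc N) n T i"
  have fin: "finite (interlacing N n)"
    unfolding interlacing_def by (intro finite_PiE) auto
  have "tableaux (Suc N) n = (\<Union>n'\<in>interlacing N n. tableaux_over N n n')"
    using tableau_shape_without_ones[OF n] unfolding tableaux_over_def by blast
  hence "schur0 (Suc N) n v = (\<Sum>T\<in>(\<Union>n'\<in>interlacing N n. tableaux_over N n n'). ?w T)"
    by (simp add: schur0_def schur_def)
  also have "\<dots> = (\<Sum>n'\<in>interlacing N n. \<Sum>T\<in>tableaux_over N n n'. ?w T)"
  proof (rule sum.UNION_disjoint[OF fin])
    show "\<forall>n'\<in>interlacing N n. finite (tableaux_over N n n')"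
      using finite_tableaux by (simp add: tableaux_over_def)
    show "\<forall>n'\<in>interlacing N n. \<forall>n''\<in>interlacing N n.
        n' \<noteq> n'' \<longrightarrow> tableaux_over N n n' \<inter> tableaux_over N n n'' = {}"
      using interlacing_determined_by_cells[OF n] unfolding tableaux_over_def by blast
  qed
  also have "\<dots> = (\<Sum>n'\<in>interlacing N n.
      v 0 ^ (n 0 + (\<Sum>k<N. n (Suc k) - Suc (n' k))) * schur0 N n' (v \<circ> Suc))"
  proof (rule sum.cong)
    fix n' assume n': "n' \<in> interlacing N n"
    let ?e = "n 0 + (\<Sum>k<N. n (Suc k) - Suc (n' k))"
    let ?w' = "\<lambda>T. v 0 ^ ?e * (\<Prod>i=1..N. ?u (Suc i) ^ occurrences N n' T i)"
    have "(\<Sum>T\<in>tableaux_over N n n'. ?w T) = (\<Sum>T\<in>tableaux_over N n n'. ?w' (remove_ones N n' T))"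
      using tableau_weight_remove_ones[OF n n', of _ ?u] by (intro sum.cong) simp_all
    also have "\<dots> = (\<Sum>T\<in>tableaux N n'. ?w' T)"
      by (rule sum.reindex_bij_witness[where i="add_ones N n n'" and j="remove_ones N n'"])
        (use n n' in \<open>simp_all add: remove_ones_tableaux add_ones_tableaux remove_add_ones
          add_remove_ones\<close>)
    also have "\<dots> = v 0 ^ ?e * schur0 N n' (v \<circ> Suc)"
      by (auto simp: schur0_def schur_def sum_distrib_left intro!: sum.cong prod.cong)
    finally show "(\<Sum>T\<in>tableaux_over N n n'. ?w T) = v 0 ^ ?e * schur0 N n' (v \<circ> Suc)" .
  qed simp
  finally show ?thesis .
qed

lemma schur_pos:
  assumes u: "\<And>i. i \<in> {1..N} \<Longrightarrow> u i > 0"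
  shows "schur N n u > 0"
  unfolding schur_def
proof (rule sum_pos)
  \<comment> \<open>All tableaux contribute positively, and the one that is constant along rows always exists.\<close>
  have "(\<lambda>(r, c)\<in>cells N n. N - r) \<in> tableaux N n"
    by (auto simp: tableaux_def cells_def)
  thus "tableaux N n \<noteq> {}" by auto
qed (auto intro!: prod_pos zero_less_power u finite_tableaux)

lemma schur0_no_cells:
  assumes "cells N n = {}"
  shows "schur0 N n v = 1"
proof -
  have "tableaux N n = {\<lambda>x. undefined}"
    using assms by (auto simp: tableaux_def)
  thus ?thesis
    using assms by (simp add: schur0_def schur_def occurrences_def)
qed

section \<open>A recursion for generalized Vandermonde determinants\<close>

definition alternant :: "nat \<Rightarrow> (nat \<Rightarrow> nat) \<Rightarrow> (nat \<Rightarrow> real) \<Rightarrow> real" where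
  "alternant N n v = det (mat N N (\<lambda>(k, j). v j ^ n k))"

fun vandermonde :: "nat \<Rightarrow> (nat \<Rightarrow> real) \<Rightarrow> real" where
  "vandermonde 0 v = 1"
| "vandermonde (Suc N) v = (\<Prod>j<N. v (Suc j) - v 0) * vandermonde N (v \<circ> Suc)"

lemma power_minus_power_telescope:
  fixes x y :: real
  assumes "a \<le> b"
  shows "y ^ b - x ^ (b - a) * y ^ a = (y - x) * (\<Sum>i\<in>{a..<b}. x ^ (b - Suc i) * y ^ i)"
proof -
  have "(\<Sum>i\<in>{a..<b}. x ^ (b - Suc i) * y ^ i) = (\<Sum>i<b - a. x ^ (b - a - Suc i) * y ^ (i + a))"
    using assms
    by (intro sum.reindex_bij_witness[where i="\<lambda>i. i + a" and j="\<lambda>i. i - a"]) auto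
  also have "\<dots> = y ^ a * (\<Sum>i<b - a. x ^ (b - a - Suc i) * y ^ i)"
    by (simp add: sum_distrib_left power_add algebra_simps)
  finally have "(y - x) * (\<Sum>i\<in>{a..<b}. x ^ (b - Suc i) * y ^ i)
      = y ^ a * (y ^ (b - a) - x ^ (b - a))"
    by (simp add: power_diff_sumr2[of y "b - a" x])
  also have "\<dots> = y ^ b - x ^ (b - a) * y ^ a"
    using assms by (simp add: right_diff_distrib power_add[symmetric] mult.commute)
  finally show ?thesis by simp
qed

text \<open>
  Multilinearity in all rows at once, with a different index set for each row.
\<close>

lemma det_rows_sum_PiE:
  fixes g :: "nat \<Rightarrow> nat \<Rightarrow> nat \<Rightarrow> real"
  assumes "\<And>k. k < N \<Longrightarrow> finite (I k)"
  shows "det (mat N N (\<lambda>(k, j). \<Sum>a\<in>I k. g k a j))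
    = (\<Sum>f\<in>Pi\<^sub>E {..<N} I. det (mat N N (\<lambda>(k, j). g k (f k) j)))"
proof -
  have perm: "p permutes {0..<N} \<Longrightarrow> i < N \<Longrightarrow> p i < N" for p i
    by (metis atLeastLessThan_iff permutes_in_image zero_le)
  have "det (mat N N (\<lambda>(k, j). \<Sum>a\<in>I k. g k a j))
      = (\<Sum>p | p permutes {0..<N}. signof p * (\<Prod>k\<in>{..<N}. \<Sum>a\<in>I k. g k a (p k)))"
    by (subst det_def'[of _ N]) (auto simp: perm atLeast0LessThan intro!: sum.cong prod.cong)
  also have "\<dots> = (\<Sum>p | p permutes {0..<N}. signof p * (\<Sum>f\<in>Pi\<^sub>E {..<N} I. \<Prod>k\<in>{..<N}. g k (f k) (p k)))"
    using assms by (subst prod_sum_PiE) auto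
  also have "\<dots> = (\<Sum>f\<in>Pi\<^sub>E {..<N} I. \<Sum>p | p permutes {0..<N}. signof p * (\<Prod>k\<in>{..<N}. g k (f k) (p k)))"
    by (simp add: sum_distrib_left sum.swap[of _ _ "Pi\<^sub>E {..<N} I"])
  also have "\<dots> = (\<Sum>f\<in>Pi\<^sub>E {..<N} I. det (mat N N (\<lambda>(k, j). g k (f k) j)))"
    by (subst det_def'[of _ N]) (auto simp: perm atLeast0LessThan intro!: sum.cong prod.cong)
  finally show ?thesis .
qed

lemma det_scale_rows_cols:
  fixes A :: "nat \<Rightarrow> nat \<Rightarrow> real"
  shows "det (mat N N (\<lambda>(k, j). c j * r k * A k j)) = (\<Prod>j<N. c j) * (\<Prod>k<N. r k) * det (mat N N (\<lambda>(k, j). A k j))"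
proof -
  have perm: "p permutes {0..<N} \<Longrightarrow> i < N \<Longrightarrow> p i < N" for p i
    by (metis atLeastLessThan_iff permutes_in_image zero_le)
  have c: "(\<Prod>k<N. c (p k)) = (\<Prod>j<N. c j)" if "p permutes {0..<N}" for p
    using prod.permute[OF that, of c] by (simp add: atLeast0LessThan o_def)
  show ?thesis
    by (subst (1 2) det_def'[of _ N])
      (auto simp: perm c[unfolded atLeast0LessThan[symmetric]] atLeast0LessThan[symmetric]
        sum_distrib_left prod.distrib intro!: sum.cong)
qed

text \<open>
  Subtract from every row \<open>x\<^sup>d\<close> times the preceding one, where \<open>x\<close> is the first point and \<open>d\<close> is the
  difference of the two exponents.  This clears the column of \<open>x\<close> below its first entry, and each
  remaining entry telescopes into \<open>y - x\<close> times a sum over the exponents between two consecutive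
  entries of \<open>n\<close>, which is exactly the range that interlacing prescribes.
\<close>

lemma alternant_Suc:
  assumes n: "strict_mono_on {..<Suc N} n"
  shows "alternant (Suc N) n v = (\<Prod>j<N. v (Suc j) - v 0) *
    (\<Sum>n'\<in>interlacing N n. v 0 ^ (n 0 + (\<Sum>k<N. n (Suc k) - Suc (n' k))) * alternant N n' (v \<circ> Suc))"
proof -
  let ?x = "v 0" and ?y = "\<lambda>j. v (Suc j)"
  define L where "L = mat (Suc N) (Suc N) (\<lambda>(k, i).
    if i = k then 1 else if Suc i = k then - (?x ^ (n k - n i)) else 0)"
  define V where "V = mat (Suc N) (Suc N) (\<lambda>(k, j). v j ^ n k)"
  have LV [simp]: "L \<in> carrier_mat (Suc N) (Suc N)" "V \<in> carrier_mat (Suc N) (Suc N)"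
    by (auto simp: L_def V_def)
  have "det L = 1"
    by (subst det_lower_triangular[of "Suc N"])
      (auto simp: L_def prod_list_diag_prod)
  hence "det V = det (L * V)"
    by (simp add: det_mult[OF LV])
  define P where "P = L * V"
  have P: "P \<in> carrier_mat (Suc N) (Suc N)"
    unfolding P_def by (rule mult_carrier_mat[OF LV])
  have entry0: "P $$ (0, j) = v j ^ n 0" if "j < Suc N" for j
    using that by (simp add: P_def L_def V_def scalar_prod_def if_distrib[of "\<lambda>a. a * _"] cong: if_cong)
  have entry: "P $$ (Suc k, j) = v j ^ n (Suc k) - ?x ^ (n (Suc k) - n k) * v j ^ n k"
    if "j < Suc N" "k < N" for j k
  proof -
    have "P $$ (Suc k, j) = (\<Sum>i<Suc N. (if i = Suc k then v j ^ n (Suc k) else 0)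
        + (if i = k then - (?x ^ (n (Suc k) - n k)) * v j ^ n k else 0))"
      using that by (simp del: sum.lessThan_Suc sum.op_ivl_Suc add: P_def L_def V_def scalar_prod_def atLeast0LessThan)
         (rule sum.cong, auto)
    also have "\<dots> = v j ^ n (Suc k) - ?x ^ (n (Suc k) - n k) * v j ^ n k"
      using that unfolding sum.distrib by simp
    finally show ?thesis .
  qed
  have mono: "n k < n (Suc k)" if "k < N" for k
    using n that by (auto simp: strict_mono_on_def)
  have "det P = (\<Sum>i<Suc N. P $$ (i, 0) * cofactor P i 0)"
    using P by (rule laplace_expansion_column) simp
  also have "\<dots> = ?x ^ n 0 * cofactor P 0 0"
    by (subst sum.lessThan_Suc_shift)
      (auto simp: entry0 entry power_add[symmetric] mono less_imp_le intro!: sum.neutral)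
  also have "cofactor P 0 0
      = det (mat N N (\<lambda>(k, j). ?y j ^ n (Suc k) - ?x ^ (n (Suc k) - n k) * ?y j ^ n k))"
    unfolding cofactor_def
    using P by (auto simp: mat_delete_def entry entry0 intro!: arg_cong[of _ _ det] eq_matI)
  also have "\<dots> = det (mat N N (\<lambda>(k, j). (?y j - ?x) * 1 *
      (\<Sum>a\<in>{n k..<n (Suc k)}. ?x ^ (n (Suc k) - Suc a) * ?y j ^ a)))"
    using mono
    by (intro arg_cong[of _ _ det] eq_matI)
       (auto simp: power_minus_power_telescope[OF less_imp_le])
  also have "\<dots> = (\<Prod>j<N. ?y j - ?x) * det (mat N N (\<lambda>(k, j).
      (\<Sum>a\<in>{n k..<n (Suc k)}. ?x ^ (n (Suc k) - Suc a) * ?y j ^ a)))"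
    by (subst det_scale_rows_cols) simp
  also have "det (mat N N (\<lambda>(k, j). (\<Sum>a\<in>{n k..<n (Suc k)}. ?x ^ (n (Suc k) - Suc a) * ?y j ^ a)))
      = (\<Sum>n'\<in>interlacing N n. det (mat N N (\<lambda>(k, j). ?x ^ (n (Suc k) - Suc (n' k)) * ?y j ^ n' k)))"
    unfolding interlacing_def by (rule det_rows_sum_PiE) simp
  also have "\<dots> = (\<Sum>n'\<in>interlacing N n. ?x ^ (\<Sum>k<N. n (Suc k) - Suc (n' k)) * alternant N n' (v \<circ> Suc))"
    using det_scale_rows_cols[of N "\<lambda>_. 1"]
    by (intro sum.cong) (auto simp: alternant_def power_sum o_def)
  finally show ?thesis
    using \<open>det V = det (L * V)\<close>
    by (simp add: alternant_def V_def P_def power_add sum_distrib_left mult_ac)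
qed

section \<open>The bialternant formula and symmetry\<close>

text \<open>
  The bialternant formula holds because both sides obey the same recursion in the first variable:
  removing the ones of a tableau and clearing the first column of the determinant both sum over
  the interlacing tuples, with the same powers.
\<close>

theorem alternant_eq_schur0_vandermonde:
  assumes "strict_mono_on {..<N} n"
  shows "alternant N n v = schur0 N n v * vandermonde N v"
  using assms
proof (induction N arbitrary: n v)
  case 0
  have "cells 0 n = {}" by (simp add: cells_def)
  then show ?case by (simp add: schur0_no_cells alternant_def)
next
  case (Suc N)
  have "alternant (Suc N) n v = (\<Prod>j<N. v (Suc j) - v 0) *
    (\<Sum>n'\<in>interlacing N n. v 0 ^ (n 0 + (\<Sum>k<N. n (Suc k) - Suc (n' k)))
      * (schur0 N n' (v \<circ> Suc) * vandermonde N (v \<circ> Suc)))"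
    unfolding alternant_Suc[OF Suc.prems]
    using Suc.IH[OF interlacing_strict_mono[OF Suc.prems]]
    by (intro arg_cong2[of _ _ _ _ "(*)"] sum.cong) (simp_all del: o_apply)
  also have "\<dots> = schur0 (Suc N) n v * vandermonde (Suc N) v"
    unfolding schur0_Suc[OF Suc.prems] by (simp add: sum_distrib_left sum_distrib_right mult_ac)
  finally show ?case .
qed

text \<open>
  The exponents \<open>0, 1, \<dots>, N - 1\<close> belong to the empty diagram, whose Schur polynomial is \<open>1\<close>.  The
  product thus inherits the sign rule for permutations of the points from the determinant.
\<close>

lemma vandermonde_eq_alternant: "vandermonde N v = alternant N (\<lambda>k. k) v"
proof -
  have "cells N (\<lambda>k. k) = {}" by (auto simp: cells_def row_length_def)
  thus ?thesis
    using alternant_eq_schur0_vandermonde[of N "\<lambda>k. k" v]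
    by (simp add: schur0_no_cells strict_mono_on_def)
qed

lemma alternant_permute:
  assumes p: "p permutes {0..<N}"
  shows "alternant N n (v \<circ> p) = of_int (sign p) * alternant N n v"
proof -
  define A where "A = mat N N (\<lambda>(j, k). v j ^ n k)"
  have A: "A \<in> carrier_mat N N" by (simp add: A_def)
  have less: "p j < N" if "j < N" for j
    using permutes_in_image[OF p, of j] that by simp
  have "alternant N n v = det (transpose_mat A)"
    unfolding alternant_def by (intro arg_cong[of _ _ det] eq_matI) (auto simp: A_def)
  moreover have "alternant N n (v \<circ> p) = det (transpose_mat (mat N N (\<lambda>(i, j). A $$ (p i, j))))"
    unfolding alternant_def by (intro arg_cong[of _ _ det] eq_matI) (auto simp: A_def less)
  ultimately show ?thesis
    by (simp add: det_transpose[OF A] det_transpose[of _ N] det_permute_rows[OF A p])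
qed

lemma vandermonde_nonzero:
  "inj_on v {..<N} \<Longrightarrow> vandermonde N v \<noteq> 0"
proof (induction N arbitrary: v)
  case (Suc N)
  have "inj_on (v \<circ> Suc) {..<N}"
    using Suc.prems by (auto simp: inj_on_def)
  moreover have "v (Suc j) \<noteq> v 0" if "j < N" for j
    using Suc.prems that by (force simp: inj_on_def)
  ultimately show ?case using Suc.IH by simp
qed simp

text \<open>
  Symmetry is invisible in the tableaux; it comes from a quotient of two alternating functions.
  Distinctness of the points makes the denominator nonzero.
\<close>

lemma schur0_permute:
  assumes n: "strict_mono_on {..<N} n" and v: "inj_on v {..<N}" and p: "p permutes {0..<N}"
  shows "schur0 N n (v \<circ> p) = schur0 N n v"
proof -
  have "(of_int (sign p) * vandermonde N v) * schur0 N n (v \<circ> p)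
      = (of_int (sign p) * vandermonde N v) * schur0 N n v"
    using alternant_permute[OF p, of n v] alternant_permute[OF p, of "\<lambda>k. k" v]
    by (simp add: alternant_eq_schur0_vandermonde[OF n] vandermonde_eq_alternant[symmetric] mult_ac)
  moreover have "of_int (sign p) * vandermonde N v \<noteq> 0"
    using vandermonde_nonzero[OF v] by (simp add: sign_def)
  ultimately show ?thesis by simp
qed

section \<open>A Pluecker relation\<close>

lemma alternant_repeated_point:
  assumes "i < N" "j < N" "i \<noteq> j" "v i = v j"
  shows "alternant N n v = 0"
proof -
  have "col (mat N N (\<lambda>(k, j). v j ^ n k)) i = col (mat N N (\<lambda>(k, j). v j ^ n k)) j"
    using assms by (intro eq_vecI) auto
  thus ?thesis unfolding alternant_def
    using det_identical_columns[of "mat N N (\<lambda>(k, j). v j ^ n k)" N i j] assms by simp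
qed

lemma cofactor_alternant:
  assumes "a < Suc N"
  shows "cofactor (mat (Suc N) (Suc N) (\<lambda>(k, j). v j ^ n k)) a 0
    = (- 1) ^ a * alternant N (n \<circ> insert_index a) (v \<circ> Suc)"
  unfolding cofactor_def alternant_def
  using assms
  by (auto simp: mat_delete_def insert_index_def intro!: arg_cong[of _ _ det] eq_matI)

lemma alternant_expand_first_point:
  "alternant (Suc N) n (case_nat x U) = (\<Sum>j<Suc N. (- 1) ^ j * x ^ n j * alternant N (n \<circ> insert_index j) U)"
proof -
  let ?A = "mat (Suc N) (Suc N) (\<lambda>(k, j). case_nat x U j ^ n k)"
  have "alternant (Suc N) n (case_nat x U) = (\<Sum>j<Suc N. ?A $$ (j, 0) * cofactor ?A j 0)"
    unfolding alternant_def by (rule laplace_expansion_column) simp_all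
  also have "\<dots> = (\<Sum>j<Suc N. (- 1) ^ j * x ^ n j * alternant N (n \<circ> insert_index j) U)"
    by (rule sum.cong) (simp_all add: cofactor_alternant o_def del: sum.lessThan_Suc)
  finally show ?thesis .
qed

text \<open>
  As a function of its first point, an alternant whose exponents are those of \<open>e\<close> without the one
  at position \<open>a\<close> is a combination of all powers \<open>x ^ e b\<close>, with coefficient \<open>0\<close> at \<open>b = a\<close>.
  Reindexing over all of \<open>e\<close> lets alternants with different omitted exponents be compared.
\<close>

lemma alternant_skip_first_point_coeffs:
  assumes a: "a \<le> Suc M"
  obtains c where "\<And>x. alternant (Suc M) (e \<circ> insert_index a) (case_nat x U) = (\<Sum>b<Suc (Suc M). c b * x ^ e b)"
    and "c a = 0"
    and "\<And>j. j < Suc M \<Longrightarrow> c (insert_index a j) = (- 1) ^ j * alternant M (e \<circ> insert_index a \<circ> insert_index j) U"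
proof -
  let ?d = "\<lambda>j. (- 1) ^ j * alternant M (e \<circ> insert_index a \<circ> insert_index j) U"
  define c where "c b = (if b = a then 0 else ?d (delete_index a b))" for b
  have c: "c (insert_index a j) = ?d j" for j by (simp add: c_def)
  have "alternant (Suc M) (e \<circ> insert_index a) (case_nat x U) = (\<Sum>b<Suc (Suc M). c b * x ^ e b)" for x
  proof -
    have "alternant (Suc M) (e \<circ> insert_index a) (case_nat x U)
        = (\<Sum>j\<in>{0..<Suc M}. c (insert_index a j) * x ^ e (insert_index a j))"
      unfolding alternant_expand_first_point atLeast0LessThan
      by (rule sum.cong) (simp_all add: c mult_ac)
    also have "\<dots> = (\<Sum>b\<in>insert_index a ` {0..<Suc M}. c b * x ^ e b)"
      by (subst sum.reindex[OF insert_index_inj_on]) simp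
    also have "\<dots> = (\<Sum>b<Suc (Suc M). c b * x ^ e b)"
      using a by (intro sum.mono_neutral_left) (auto simp: insert_index_image c_def)
    finally show ?thesis .
  qed
  moreover have "c a = 0" by (simp add: c_def)
  ultimately show ?thesis using that c by blast
qed

text \<open>
  A three-term Pluecker relation.  The function \<open>h x = F x * G s - F s * G x\<close> is a combination of the
  powers with exponents in \<open>e\<close>; it vanishes at \<open>s\<close> and at every point of \<open>U\<close>.  Hence in the square
  system given by the points \<open>t\<close>, \<open>s\<close>, \<open>U\<close>, the coefficient vector of \<open>h\<close> is mapped to a vector whose
  only nonzero entry is \<open>h t\<close>.  Cramer's rule for the coefficient at position \<open>k + 1\<close> gives the
  relation up to a factor \<open>G s\<close>, which is why \<open>G s\<close> is assumed to be nonzero.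
\<close>

lemma alternant_plucker:
  fixes U :: "nat \<Rightarrow> real" and e :: "nat \<Rightarrow> nat"
  assumes k: "k < Suc M"
  defines "F \<equiv> \<lambda>x. alternant (Suc M) (e \<circ> insert_index k) (case_nat x U)"
    and "G \<equiv> \<lambda>x. alternant (Suc M) (e \<circ> insert_index (Suc k)) (case_nat x U)"
  assumes G: "G s \<noteq> 0"
  shows "F t * G s - F s * G t
    = alternant (Suc (Suc M)) e (case_nat s (case_nat t U)) * alternant M (e \<circ> insert_index k \<circ> insert_index k) U"
proof -
  let ?C = "alternant M (e \<circ> insert_index k \<circ> insert_index k) U"
  let ?N = "Suc (Suc M)"
  obtain c where c: "\<And>x. F x = (\<Sum>b<?N. c b * x ^ e b)"
      "\<And>j. j < Suc M \<Longrightarrow> c (insert_index k j) = (- 1) ^ j * alternant M (e \<circ> insert_index k \<circ> insert_index j) U"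
    using alternant_skip_first_point_coeffs[of k M e U] k unfolding F_def by (metis less_imp_le)
  obtain d where d: "\<And>x. G x = (\<Sum>b<?N. d b * x ^ e b)" "d (Suc k) = 0"
    using alternant_skip_first_point_coeffs[of "Suc k" M e U] k unfolding G_def by (metis Suc_leI)
  define h where "h x = F x * G s - F s * G x" for x
  define w where "w b = c b * G s - F s * d b" for b
  have h: "h x = (\<Sum>b<?N. w b * x ^ e b)" for x
    unfolding h_def c(1)[of x] d(1)[of x] w_def
    by (simp add: sum_distrib_left sum_distrib_right sum_subtractf algebra_simps del: sum.lessThan_Suc)
  have wk: "w (Suc k) = (- 1) ^ k * ?C * G s"
    using c(2)[OF k] d(2) by (simp add: w_def)
  define P where "P = case_nat t (case_nat s U)"
  define A where "A = mat ?N ?N (\<lambda>(b, j). P j ^ e b)"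
  have A: "A \<in> carrier_mat ?N ?N" by (simp add: A_def)
  have detA: "det A = alternant ?N e P" by (simp add: A_def alternant_def)
  have adj: "(\<Sum>j<?N. A $$ (b, j) * cofactor A (Suc k) j) = (if b = Suc k then det A else 0)"
    if b: "b < ?N" for b
  proof -
    have "(A * adj_mat A) $$ (b, Suc k) = (det A \<cdot>\<^sub>m 1\<^sub>m ?N) $$ (b, Suc k)"
      by (simp add: adj_mat(2)[OF A])
    moreover have "(A * adj_mat A) $$ (b, Suc k) = (\<Sum>j<?N. A $$ (b, j) * cofactor A (Suc k) j)"
      using b k A by (simp add: adj_mat_def scalar_prod_def atLeast0LessThan del: sum.lessThan_Suc sum.op_ivl_Suc)
    ultimately show ?thesis using b k by auto
  qed
  have zero: "h (P (Suc j)) = 0" if "j < Suc M" for j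
  proof (cases j)
    case 0
    thus ?thesis by (simp add: P_def h_def)
  next
    case (Suc i)
    have "F (U i) = 0" "G (U i) = 0"
      unfolding F_def G_def using Suc that by (auto intro!: alternant_repeated_point[of 0 _ "Suc i"])
    thus ?thesis by (simp add: P_def h_def Suc)
  qed
  \<comment> \<open>Cramer's rule, read off from the product of A and its adjugate\<close>
  have "w (Suc k) * det A = (\<Sum>b<?N. w b * (\<Sum>j<?N. A $$ (b, j) * cofactor A (Suc k) j))"
    using k by (simp add: adj if_distrib[of "\<lambda>x. _ * x"] cong: if_cong del: sum.lessThan_Suc)
  also have "\<dots> = (\<Sum>j<?N. (\<Sum>b<?N. w b * A $$ (b, j)) * cofactor A (Suc k) j)"
    unfolding sum_distrib_left sum_distrib_right by (subst sum.swap) (simp only: mult.assoc)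
  also have "\<dots> = (\<Sum>j<?N. h (P j) * cofactor A (Suc k) j)"
    by (intro sum.cong refl) (simp add: h A_def del: sum.lessThan_Suc)
  also have "\<dots> = h (P 0) * cofactor A (Suc k) 0"
    by (subst sum.lessThan_Suc_shift) (simp add: zero)
  also have "cofactor A (Suc k) 0 = - ((- 1) ^ k) * G s"
    using k cofactor_alternant[of "Suc k" "Suc M" P e] by (simp add: A_def G_def P_def o_def)
  finally have "G s * ((- 1) ^ k * (h t + ?C * det A)) = 0"
    unfolding wk by (simp add: P_def algebra_simps)
  hence "h t + ?C * det A = 0"
    using G by simp
  hence "h t = - det A * ?C"
    by (simp add: algebra_simps)
  moreover have "alternant ?N e (case_nat s (case_nat t U)) = - det A"
  proof -
    have "case_nat s (case_nat t U) = P \<circ> transpose 0 1"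
      by (auto simp: P_def fun_eq_iff transpose_def split: nat.split)
    thus ?thesis
      using alternant_permute[OF permutes_swap_id[of 0 "{0..<?N}" 1], of e P]
      by (simp add: detA sign_swap_id)
  qed
  ultimately show ?thesis by (simp add: h_def)
qed

lemma vandermonde_case_nat:
  "vandermonde (Suc N) (case_nat x U) = (\<Prod>j<N. U j - x) * vandermonde N U"
  by (simp add: o_def)

lemma schur0_pos:
  "(\<And>j. j < N \<Longrightarrow> v j > 0) \<Longrightarrow> schur0 N n v > 0"
  unfolding schur0_def by (rule schur_pos) auto

lemma strict_mono_on_insert_index:
  assumes "strict_mono_on {..<Suc N} e"
  shows "strict_mono_on {..<N} (e \<circ> insert_index a)"
  by (rule strict_mono_onI) (use assms in \<open>auto simp: insert_index_def strict_mono_on_def\<close>)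

text \<open>
  Division of the relation between alternants by their Vandermonde factors.  Those of the
  two sides agree except for the difference of the points \<open>s\<close> and \<open>t\<close>, which occur together only in
  the longer tuple.  The remaining factor \<open>t - s\<close> is the source of monotonicity.
\<close>

lemma schur0_plucker:
  assumes e: "strict_mono_on {..<Suc (Suc M)} e" and k: "k < Suc M"
    and U: "inj_on U {..<M}" "\<And>j. j < M \<Longrightarrow> U j \<noteq> s" "\<And>j. j < M \<Longrightarrow> U j \<noteq> t"
    and pos: "\<And>j. j < M \<Longrightarrow> U j > 0" "s > 0"
  defines "S \<equiv> \<lambda>a x. schur0 (Suc M) (e \<circ> insert_index a) (case_nat x U)"
  shows "S k t * S (Suc k) s - S k s * S (Suc k) t = (t - s) *
    (schur0 (Suc (Suc M)) e (case_nat s (case_nat t U)) * schur0 M (e \<circ> insert_index k \<circ> insert_index k) U)"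
    (is "_ = (t - s) * (?E * ?C)")
proof -
  let ?\<pi> = "\<lambda>x. \<Prod>j<M. U j - x" and ?V = "vandermonde M U"
  have V: "alternant (Suc M) (e \<circ> insert_index a) (case_nat x U) = S a x * (?\<pi> x * ?V)" for a x
    unfolding S_def
    by (simp only: alternant_eq_schur0_vandermonde[OF strict_mono_on_insert_index[OF e]] vandermonde_case_nat)
  have VC: "alternant M (e \<circ> insert_index k \<circ> insert_index k) U = ?C * ?V"
    by (rule alternant_eq_schur0_vandermonde) (intro strict_mono_on_insert_index e)
  have VE: "alternant (Suc (Suc M)) e (case_nat s (case_nat t U)) = ?E * ((t - s) * ?\<pi> s * (?\<pi> t * ?V))"
    unfolding alternant_eq_schur0_vandermonde[OF e] vandermonde_case_nat
    by (subst prod.lessThan_Suc_shift) simp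
  have nz: "?\<pi> s \<noteq> 0" "?\<pi> t \<noteq> 0" "?V \<noteq> 0"
    using U vandermonde_nonzero[OF U(1)] by auto
  have "S (Suc k) s > 0"
    unfolding S_def
    by (rule schur0_pos) (use pos in \<open>auto split: nat.split\<close>)
  hence "alternant (Suc M) (e \<circ> insert_index (Suc k)) (case_nat s U) \<noteq> 0"
    unfolding V using nz by simp
  from alternant_plucker[OF k this, of t]
  have "(?\<pi> t * ?V * (?\<pi> s * ?V)) * (S k t * S (Suc k) s - S k s * S (Suc k) t)
      = (?\<pi> t * ?V * (?\<pi> s * ?V)) * ((t - s) * (?E * ?C))"
    unfolding V VC VE by (simp add: algebra_simps)
  thus ?thesis using nz by simp
qed

text \<open>
  Two admissible tuples that differ in a single entry arise from a common longer tuple by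
  omitting one of two neighbouring entries; this brings them into the form of the relation above.
\<close>

lemma fun_upd_eq_insert_index:
  fixes n :: "nat \<Rightarrow> nat"
  assumes "strict_mono_on {..<N} n" "strict_mono_on {..<N} (n(k := q))" "n k < q" "k < N"
  obtains e where "strict_mono_on {..<Suc N} e"
    "e \<circ> insert_index k = n(k := q)" "e \<circ> insert_index (Suc k) = n"
proof
  let ?e = "\<lambda>j. if j \<le> k then n j else if j = Suc k then q else n (j - 1)"
  have below: "n j < q" if "j \<le> k" for j
    using that assms strict_mono_on_leD[OF assms(1), of j k] by (auto intro: le_less_trans)
  have above: "q < n j" if "k < j" "j < N" for j
    using strict_mono_onD[OF assms(2), of k j] that by simp
  have strict: "n i < n j" if "i < j" "j < N" for i j
    using strict_mono_onD[OF assms(1), of i j] that by simp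
  show "strict_mono_on {..<Suc N} ?e"
  proof (rule strict_mono_onI)
    fix i j assume "i \<in> {..<Suc N}" "j \<in> {..<Suc N}" "i < j"
    thus "?e i < ?e j"
      using below[of i] above[of "j - 1"] strict[of i j] strict[of i "j - 1"] strict[of "i - 1" "j - 1"] \<open>k < N\<close>
      by auto
  qed
  show "?e \<circ> insert_index k = n(k := q)" "?e \<circ> insert_index (Suc k) = n"
    by (auto simp: fun_eq_iff insert_index_def)
qed

text \<open>
  The inequality is cross-multiplied because it is then stable under limits.  By symmetry the
  varying coordinate \<open>i\<close> can be moved to the front.
\<close>

lemma schur0_cross_le_distinct:
  assumes n: "strict_mono_on {..<N} n" "strict_mono_on {..<N} (n(k := q))" "n k < q" "k < N"
    and i: "i < N" and st: "0 < s" "s < t"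
    and v: "\<And>j. j < N \<Longrightarrow> v j > 0" "inj_on (v(i := s)) {..<N}" "inj_on (v(i := t)) {..<N}"
  shows "schur0 N (n(k := q)) (v(i := s)) * schur0 N n (v(i := t))
    \<le> schur0 N (n(k := q)) (v(i := t)) * schur0 N n (v(i := s))"
proof -
  obtain M where N: "N = Suc M" using i by (cases N) auto
  define \<tau> where "\<tau> = transpose 0 i"
  define U where "U = (\<lambda>j. v (\<tau> (Suc j)))"
  have \<tau>: "\<tau> permutes {0..<N}"
    unfolding \<tau>_def using i by (intro permutes_swap_id) auto
  have upd: "v(i := x) \<circ> \<tau> = case_nat x U" for x
    by (auto simp: fun_eq_iff \<tau>_def U_def transpose_def split: nat.split)
  have \<tau>_less: "\<tau> j < N" if "j < N" for j
    using permutes_in_image[OF \<tau>, of j] that by simp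
  have inj: "inj_on (case_nat x U) {..<N}" if "inj_on (v(i := x)) {..<N}" for x
    unfolding upd[symmetric]
    using comp_inj_on[of \<tau> "{0..<N}" "v(i := x)"] permutes_image[OF \<tau>] permutes_inj_on[OF \<tau>] that
    by (simp add: atLeast0LessThan)
  have eq: "schur0 N n' (v(i := x)) = schur0 N n' (case_nat x U)"
    if "strict_mono_on {..<N} n'" "inj_on (v(i := x)) {..<N}" for n' x
    using schur0_permute[OF that \<tau>] unfolding upd by simp
  have U: "U j > 0" "U j \<noteq> s" "U j \<noteq> t" if "j < M" for j
    using v(1)[OF \<tau>_less[of "Suc j"]] inj_onD[OF inj[OF v(2)], of 0 "Suc j"]
      inj_onD[OF inj[OF v(3)], of 0 "Suc j"] that by (auto simp: U_def N)
  have Uinj: "inj_on U {..<M}"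
  proof (rule inj_onI)
    fix a b assume "a \<in> {..<M}" "b \<in> {..<M}" "U a = U b"
    thus "a = b" using inj_onD[OF inj[OF v(2)], of "Suc a" "Suc b"] by (simp add: N)
  qed
  obtain e where e: "strict_mono_on {..<Suc N} e"
      "e \<circ> insert_index k = n(k := q)" "e \<circ> insert_index (Suc k) = n"
    using fun_upd_eq_insert_index[OF n] .
  have "0 \<le> (t - s) * (schur0 (Suc N) e (case_nat s (case_nat t U))
      * schur0 M (e \<circ> insert_index k \<circ> insert_index k) U)"
  proof (intro mult_nonneg_nonneg)
    show "0 \<le> schur0 (Suc N) e (case_nat s (case_nat t U))"
      by (rule less_imp_le, rule schur0_pos)
        (use st U in \<open>auto simp: N split: nat.split\<close>)
    show "0 \<le> schur0 M (e \<circ> insert_index k \<circ> insert_index k) U"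
      using U(1) by (intro less_imp_le schur0_pos)
  qed (use st in simp)
  also have "\<dots> = schur0 N (n(k := q)) (case_nat t U) * schur0 N n (case_nat s U)
      - schur0 N (n(k := q)) (case_nat s U) * schur0 N n (case_nat t U)"
    using schur0_plucker[of M e k U s t] e n(4) U Uinj st by (simp add: N)
  finally show ?thesis
    using eq[OF n(1)] eq[OF n(2)] v by simp
qed

section \<open>Coinciding points\<close>

lemma tendsto_schur0:
  assumes "\<And>j. j < N \<Longrightarrow> ((\<lambda>x. w x j) \<longlongrightarrow> v j) A"
  shows "((\<lambda>x. schur0 N n (w x)) \<longlongrightarrow> schur0 N n v) A"
  unfolding schur0_def schur_def
  by (intro tendsto_sum tendsto_prod tendsto_power assms) auto

lemma eventually_affine_neq:
  fixes a b c d :: real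
  assumes "b \<noteq> d"
  shows "eventually (\<lambda>\<epsilon>. a + \<epsilon> * b \<noteq> c + \<epsilon> * d) (at_right 0)"
proof -
  have "eventually (\<lambda>\<epsilon>. \<epsilon> \<noteq> (c - a) / (b - d)) (at_right 0)"
    by (rule eventually_neq_at_within)
  thus ?thesis
    by eventually_elim (use assms in \<open>auto simp: field_simps\<close>)
qed

lemma eventually_inj_on_perturbation:
  fixes a b :: "nat \<Rightarrow> real"
  assumes "inj_on b {..<N}"
  shows "eventually (\<lambda>\<epsilon>. inj_on (\<lambda>j. a j + \<epsilon> * b j) {..<N}) (at_right 0)"
proof -
  have "eventually (\<lambda>\<epsilon>. \<forall>i\<in>{..<N}. \<forall>j\<in>{..<N}. i \<noteq> j \<longrightarrow> a i + \<epsilon> * b i \<noteq> a j + \<epsilon> * b j) (at_right 0)"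
  proof (intro eventually_ball_finite ballI finite_lessThan)
    fix i j assume ij: "i \<in> {..<N}" "j \<in> {..<N}"
    show "eventually (\<lambda>\<epsilon>. i \<noteq> j \<longrightarrow> a i + \<epsilon> * b i \<noteq> a j + \<epsilon> * b j) (at_right 0)"
    proof (cases "i = j")
      case False
      hence "b i \<noteq> b j" using assms ij by (auto dest: inj_onD)
      from eventually_affine_neq[OF this, of "a i" "a j"] show ?thesis
        by eventually_elim simp
    qed simp
  qed
  thus ?thesis by eventually_elim (auto simp: inj_on_def)
qed

text \<open>
  Coinciding points are approached by distinct ones: the coordinates other than \<open>i\<close> are shifted by
  pairwise different nonzero multiples of \<open>\<epsilon>\<close>, so that only finitely many \<open>\<epsilon>\<close> produce a coincidence
  among them or with the value at \<open>i\<close>.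
\<close>

lemma schur0_cross_le:
  assumes n: "strict_mono_on {..<N} n" "strict_mono_on {..<N} (n(k := q))" "n k < q" "k < N"
    and i: "i < N" and st: "0 < s" "s < t"
    and v: "\<And>j. j < N \<Longrightarrow> v j > 0"
  shows "schur0 N (n(k := q)) (v(i := s)) * schur0 N n (v(i := t))
    \<le> schur0 N (n(k := q)) (v(i := t)) * schur0 N n (v(i := s))"
proof -
  define w where "w \<epsilon> j = v j + \<epsilon> * real (Suc j)" for \<epsilon> j
  have upd: "(w \<epsilon>)(i := x) = (\<lambda>j. (v(i := x)) j + \<epsilon> * (if j = i then 0 else real (Suc j)))" for \<epsilon> x
    by (auto simp: w_def)
  have inj: "eventually (\<lambda>\<epsilon>. inj_on ((w \<epsilon>)(i := x)) {..<N}) (at_right 0)" for x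
    unfolding upd by (rule eventually_inj_on_perturbation) (auto simp: inj_on_def)
  have lim: "((\<lambda>\<epsilon>. schur0 N n' ((w \<epsilon>)(i := x))) \<longlongrightarrow> schur0 N n' (v(i := x))) (at_right 0)" for n' x
    unfolding upd by (rule tendsto_schur0) (auto intro!: tendsto_eq_intros)
  show ?thesis
  proof (rule tendsto_le)
    show "at_right (0::real) \<noteq> bot" by simp
    show "((\<lambda>\<epsilon>. schur0 N (n(k := q)) ((w \<epsilon>)(i := t)) * schur0 N n ((w \<epsilon>)(i := s)))
        \<longlongrightarrow> schur0 N (n(k := q)) (v(i := t)) * schur0 N n (v(i := s))) (at_right 0)"
      by (intro tendsto_mult lim)
    show "((\<lambda>\<epsilon>. schur0 N (n(k := q)) ((w \<epsilon>)(i := s)) * schur0 N n ((w \<epsilon>)(i := t)))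
        \<longlongrightarrow> schur0 N (n(k := q)) (v(i := s)) * schur0 N n (v(i := t))) (at_right 0)"
      by (intro tendsto_mult lim)
    have "eventually (\<lambda>\<epsilon>::real. \<epsilon> > 0) (at_right 0)"
      by (rule eventually_at_right_less)
    with inj[of s] inj[of t]
    show "eventually (\<lambda>\<epsilon>. schur0 N (n(k := q)) ((w \<epsilon>)(i := s)) * schur0 N n ((w \<epsilon>)(i := t))
        \<le> schur0 N (n(k := q)) ((w \<epsilon>)(i := t)) * schur0 N n ((w \<epsilon>)(i := s))) (at_right 0)"
    proof eventually_elim
      case (elim \<epsilon>)
      have "w \<epsilon> j > 0" if "j < N" for j
        using v[OF that] elim by (simp add: w_def add_pos_nonneg)
      with elim show ?case
        by (intro schur0_cross_le_distinct[OF n i st]) auto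
    qed
  qed
qed

section \<open>Monotonicity of the ratio\<close>

lemma schur0_cong_exponents:
  assumes "\<And>j. j < N \<Longrightarrow> n j = n' j"
  shows "schur0 N n = schur0 N n'"
proof -
  have "cells N n = cells N n'"
    unfolding cells_def row_length_def by (intro Sigma_cong) (auto simp: assms)
  thus ?thesis by (simp add: schur0_def schur_def tableaux_def occurrences_def fun_eq_iff)
qed

lemma schur_fun_upd:
  assumes "i \<in> {1..N}"
  shows "schur N n (u(i := x)) = schur0 N n ((\<lambda>j. u (Suc j))(i - 1 := x))"
  unfolding schur0_def schur_def
  by (intro sum.cong prod.cong) (use assms in auto)

theorem proposition1p13:
  fixes N :: nat and n m :: "nat \<Rightarrow> nat"
  assumes "N > 0"
    and "strict_mono_on {..<N} n"
    and "strict_mono_on {..<N} m"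
    and "\<And>j. j < N \<Longrightarrow> n j \<le> m j"
  shows "\<forall>i\<in>{1..N}. \<forall>u :: nat \<Rightarrow> real. (\<forall>j\<in>{1..N}. u j > 0) \<longrightarrow>
           mono_on {0<..} (\<lambda>t. schur N m (u(i := t)) / schur N n (u(i := t)))"
proof (intro ballI allI impI mono_onI)
  fix i and u :: "nat \<Rightarrow> real" and s t :: real
  assume i: "i \<in> {1..N}" and u: "\<forall>j\<in>{1..N}. u j > 0"
    and st: "s \<in> {0<..}" "t \<in> {0<..}" "s \<le> t"
  define v where "v = (\<lambda>j. u (Suc j))"
  have v: "v j > 0" if "j < N" for j using u that by (simp add: v_def)
  let ?S = "\<lambda>n (x::real). schur0 N n (v(i - 1 := x))"
  \<comment> \<open>From m down to n one entry at a time, lowest first: at each stage the entries of n stand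
    below the remaining entries of m, so that the tuple is strictly increasing.\<close>
  define mix where "mix k j = (if j < k then n j else m j)" for k j
  have mix: "strict_mono_on {..<N} (mix k)" for k
  proof (rule strict_mono_onI)
    fix a b assume ab: "a \<in> {..<N}" "b \<in> {..<N}" "a < b"
    show "mix k a < mix k b"
      using strict_mono_onD[OF assms(2) ab] strict_mono_onD[OF assms(3) ab] assms(4)[of a] ab
      by (auto simp: mix_def)
  qed
  have pos: "?S (mix k) x > 0" if "x > 0" for k x
    by (rule schur0_pos) (use v that in auto)
  have step: "?S (mix k) s / ?S (mix k) t \<le> ?S (mix (Suc k)) s / ?S (mix (Suc k)) t" if k: "k < N" for k
  proof -
    have eq: "mix k = (mix (Suc k))(k := m k)" by (auto simp: mix_def)
    have "?S (mix k) s * ?S (mix (Suc k)) t \<le> ?S (mix k) t * ?S (mix (Suc k)) s"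
    proof (cases "s = t \<or> n k = m k")
      case True
      thus ?thesis
      proof
        assume "n k = m k"
        hence "mix k = mix (Suc k)" by (auto simp: mix_def less_Suc_eq)
        thus ?thesis by simp
      qed simp
    next
      case False
      have "mix (Suc k) k < m k" using False assms(4)[OF k] by (simp add: mix_def)
      thus ?thesis
        unfolding eq using False st i k mix[of k, unfolded eq]
        by (intro schur0_cross_le mix v) auto
    qed
    thus ?thesis using pos[of t] st by (simp add: field_simps)
  qed
  have "?S (mix 0) s / ?S (mix 0) t \<le> ?S (mix k) s / ?S (mix k) t" if "k \<le> N" for k
    using that
  proof (induction k)
    case (Suc k)
    hence "k \<le> N" "k < N" by simp_all
    from order_trans[OF Suc.IH[OF this(1)] step[OF this(2)]] show ?case .
  qed simp
  from this[of N] have "?S m s / ?S m t \<le> ?S n s / ?S n t"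
    using schur0_cong_exponents[of N "mix N" n] schur0_cong_exponents[of N "mix 0" m]
    by (simp add: mix_def)
  moreover have "?S m s > 0" "?S m t > 0" "?S n s > 0" "?S n t > 0"
    using st v by (auto intro!: schur0_pos)
  ultimately have "?S m s / ?S n s \<le> ?S m t / ?S n t"
    by (simp add: field_simps)
  thus "schur N m (u(i := s)) / schur N n (u(i := s)) \<le> schur N m (u(i := t)) / schur N n (u(i := t))"
    unfolding schur_fun_upd[OF i] v_def .
qed

end
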